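(* Let $R$ be a unital ring, let $M$ be a left $R$-module and let $E=\mathrm{End}(M)$ be its ring of endomorphisms. The following conditions are equivalent: 1. $\mathcal{S}(M)$ has deviation. 2. $\mathcal{S}({}_EE)$ has deviation. 3. $\mathcal{S}(E_E)$ has deviation. 4. The poset of all idempotents of $E$ has deviation. 5. The dual of the poset of all idempotents of $E$ has deviation. Moreover, if $M$ satisfies the conditions above, then $$\mathrm{dev}\,\mathcal{S}(M)=\mathrm{dev}\,\mathcal{S}({}_EE)=\mathrm{dev}\,\mathcal{S}(E_E),$$ and this ordinal is equal to the deviation of the poset of idempotents of $E$ and to the deviation of the dual of the poset of idempotents of $E$.
   Context: For a (left or right) module $N$, $\mathcal{S}(N)$ denotes the set of all direct summands of $N$, partially ordered by inclusion. For idempotents $e,e'$ of a ring $E$, write $e\leq e'$ when $ee'=e=e'e$; this makes the set of all idempotents of $E$ a poset. The deviation $\mathrm{dev}\,A$ of a poset $A$ is defined recursively: $\mathrm{dev}\,A=-1$ if $A$ is discrete (i.e. $a\leq b$ in $A$ implies $a=b$); and $\mathrm{dev}\,A=\alpha$ for an ordinal $\alpha$ if $A$ does not have deviation $\beta$ for any $\beta<\alpha$ (including $\beta=-1$) and for every descending chain $a_1\geq a_2\geq\cdots$ in $A$ the interval $[a_{n+1},a_n]$, as a subposet of $A$, has deviation $<\alpha$ for all but finitely many $n$. A poset has deviation if $\mathrm{dev}\,A=\alpha$ for some such $\alpha$ (or $-1$). *)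

theory Defs
  imports "HOL-Algebra.Module" "HOL-Algebra.AbelCoset"
begin

unbundle cardinal_syntax

section \<open>Deviation of a poset\<close>

text \<open>
  Ordinals are represented by well-orders, compared by \<open><o\<close> and identified up to \<open>=o\<close>.
  A deviation is either \<open>-1\<close> or an ordinal.
\<close>

datatype 'b deviation = Minus_One | Ordinal "'b rel"

text \<open>
  A poset is given by its carrier \<open>A\<close> and its order \<open>leq\<close> (only its values on \<open>A\<close> matter).
\<close>

definition interval :: "'a set \<Rightarrow> ('a \<Rightarrow> 'a \<Rightarrow> bool) \<Rightarrow> 'a \<Rightarrow> 'a \<Rightarrow> 'a set" where
  "interval A leq a b = {x \<in> A. leq a x \<and> leq x b}"

text \<open>
  \<open>has_dev A leq \<alpha>\<close> means \<open>dev A = \<alpha>\<close>. The ordinals below \<open>r\<close> may be taken over the same type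
  as \<open>r\<close>, since each of them is isomorphic to a proper initial segment of \<open>r\<close>.
\<close>

context
  notes conj_cong [fundef_cong]
begin

function has_dev :: "'a set \<Rightarrow> ('a \<Rightarrow> 'a \<Rightarrow> bool) \<Rightarrow> 'b deviation \<Rightarrow> bool" where
  "has_dev A leq Minus_One \<longleftrightarrow> (\<forall>a\<in>A. \<forall>b\<in>A. leq a b \<longrightarrow> a = b)"
| "has_dev A leq (Ordinal r) \<longleftrightarrow>
     Well_order r \<and>
     \<not> has_dev A leq Minus_One \<and>
     (\<forall>s. s <o r \<longrightarrow> \<not> has_dev A leq (Ordinal s)) \<and>
     (\<forall>a :: nat \<Rightarrow> 'a. (\<forall>n. a n \<in> A) \<and> (\<forall>n. leq (a (Suc n)) (a n)) \<longrightarrow>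
        (\<exists>N. \<forall>n\<ge>N.
           has_dev (interval A leq (a (Suc n)) (a n)) leq Minus_One \<or>
           (\<exists>s. s <o r \<and> has_dev (interval A leq (a (Suc n)) (a n)) leq (Ordinal s))))"
  by pat_completeness auto
termination
proof (relation "inv_image (less_than <*lex*> ordLess)
    (\<lambda>(A, leq, \<alpha>). case \<alpha> of Minus_One \<Rightarrow> (0::nat, {}) | Ordinal r \<Rightarrow> (1, r))")
qed (auto intro: wf_ordLess)

end

declare has_dev.simps [simp del]

text \<open>
  There is no type of all ordinals in HOL, so a type has to be chosen for the witness. The choice
  made here is not a restriction: by \<open>has_deviationI\<close> below, a poset whose deviation is
  an ordinal over any type at all satisfies \<open>has_deviation\<close>.
\<close>

definition has_deviation :: "'a set \<Rightarrow> ('a \<Rightarrow> 'a \<Rightarrow> bool) \<Rightarrow> bool" where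
  "has_deviation A leq \<longleftrightarrow> (\<exists>\<alpha> :: ('a \<times> 'a) deviation. has_dev A leq \<alpha>)"

lemma ordLess_transfer:
  fixes r :: "'b rel" and r' :: "'c rel"
  assumes "s <o r" "r =o r'"
  obtains s' :: "'c rel" where "s' <o r'" "s =o s'"
proof -
  have "s <o r'" using assms by (rule ordLess_ordIso_trans)
  from iffD1[OF internalize_ordLess this] show ?thesis using that by blast
qed

lemma has_dev_ordIso:
  fixes r :: "'b rel" and r' :: "'c rel"
  assumes "r =o r'"
  shows "has_dev A leq (Ordinal r) \<longleftrightarrow> has_dev A leq (Ordinal r')"
  using assms
proof (induction r arbitrary: r' A rule: wf_induct_rule[OF wf_ordLess])
  case (1 r)
  have iso': "r' =o r" using 1(2) ordIso_symmetric by blast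
  have wo: "Well_order r \<longleftrightarrow> Well_order r'"
    using 1(2) unfolding ordIso_def by auto
  have ex: "(\<exists>s :: 'b rel. s <o r \<and> has_dev B leq (Ordinal s)) \<longleftrightarrow>
      (\<exists>s :: 'c rel. s <o r' \<and> has_dev B leq (Ordinal s))" (is "?L \<longleftrightarrow> ?R") for B
  proof
    assume ?L
    then obtain s :: "'b rel" where s: "s <o r" "has_dev B leq (Ordinal s)" by blast
    obtain t :: "'c rel" where t: "t <o r'" "s =o t"
      using ordLess_transfer[OF s(1) 1(2)] by blast
    then show ?R using 1(1)[OF s(1) t(2)] s by blast
  next
    assume ?R
    then obtain s :: "'c rel" where s: "s <o r'" "has_dev B leq (Ordinal s)" by blast
    obtain t :: "'b rel" where t: "t <o r" "s =o t"
      using ordLess_transfer[OF s(1) iso'] by blast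
    then show ?L using 1(1)[OF t(1) ordIso_symmetric[OF t(2)]] s by blast
  qed
  have m1: "has_dev B leq (Minus_One :: 'b deviation) \<longleftrightarrow> has_dev B leq (Minus_One :: 'c deviation)"
    for B by (simp add: has_dev.simps)
  have no: "(\<forall>s :: 'b rel. s <o r \<longrightarrow> \<not> has_dev A leq (Ordinal s)) \<longleftrightarrow>
      (\<forall>s :: 'c rel. s <o r' \<longrightarrow> \<not> has_dev A leq (Ordinal s))"
    using ex[of A] by blast
  show ?case
    unfolding has_dev.simps(2)[of A leq r] has_dev.simps(2)[of A leq r'] wo m1 ex no
    by (rule refl)
qed

lemma has_dev_Well_order: "has_dev A leq (Ordinal r) \<Longrightarrow> Well_order r"
  unfolding has_dev.simps(2)[of A leq r] by (rule conjunct1)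

lemma has_dev_not_less:
  fixes r s :: "'b rel"
  shows "has_dev A leq (Ordinal r) \<Longrightarrow> s <o r \<Longrightarrow> \<not> has_dev A leq (Ordinal s)"
  unfolding has_dev.simps(2)[of A leq r] by (elim conjE) (rule mp, erule spec)

lemma has_dev_unique:
  fixes r :: "'b rel" and r' :: "'c rel"
  assumes "has_dev A leq (Ordinal r)" "has_dev A leq (Ordinal r')"
  shows "r =o r'"
proof -
  have "Well_order r" "Well_order r'" using assms by (auto dest: has_dev_Well_order)
  then consider "r <o r'" | "r' <o r" | "r =o r'"
    using ordLess_or_ordLeq ordLeq_iff_ordLess_or_ordIso by blast
  then show ?thesis
  proof cases
    case 1
    have "r' =o r'" using \<open>Well_order r'\<close> by (rule ordIso_reflexive)
    then obtain s :: "'c rel" where "s <o r'" "r =o s" using ordLess_transfer[OF 1] by blast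
    then show ?thesis using has_dev_not_less[OF assms(2)] assms(1) has_dev_ordIso by blast
  next
    case 2
    have "r =o r" using \<open>Well_order r\<close> by (rule ordIso_reflexive)
    then obtain s :: "'b rel" where "s <o r" "r' =o s" using ordLess_transfer[OF 2] by blast
    then show ?thesis using has_dev_not_less[OF assms(1)] assms(2) has_dev_ordIso by blast
  qed
qed

lemma has_dev_interval:
  fixes r s :: "'b rel"
  assumes tr: "transp_on A leq"
    and "has_dev A leq (Ordinal r)" and "s <o r"
  shows "\<exists>a\<in>A. \<exists>b\<in>A. has_dev (interval A leq a b) leq (Ordinal s)"
  using assms
proof (induction r arbitrary: A rule: wf_induct_rule[OF wf_ordLess])
  case (1 r)
  have ws: "Well_order s" using 1(4) by (auto simp: ordLess_def)
  note D = iffD1[OF has_dev.simps(2) 1(3)]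
  note nm = D[THEN conjunct2, THEN conjunct1]
    and nd = D[THEN conjunct2, THEN conjunct2, THEN conjunct1, rule_format]
    and ch = D[THEN conjunct2, THEN conjunct2, THEN conjunct2, rule_format]
  have "\<not> has_dev A leq (Ordinal s)" using nd 1(4) by blast
  then obtain a where a: "\<And>n. a n \<in> A" "\<And>n. leq (a (Suc n)) (a n)"
    and inf: "\<And>N. \<exists>n\<ge>N. \<not> (has_dev (interval A leq (a (Suc n)) (a n)) leq (Minus_One :: 'b deviation) \<or>
           (\<exists>t :: 'b rel. t <o s \<and> has_dev (interval A leq (a (Suc n)) (a n)) leq (Ordinal t)))"
  proof -
    have "\<forall>t :: 'b rel. t <o s \<longrightarrow> \<not> has_dev A leq (Ordinal t)"
      using nd ordLess_transitive[OF _ 1(4)] by blast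
    with \<open>\<not> has_dev A leq (Ordinal s)\<close> ws nm
    have "\<not> (\<forall>a. (\<forall>n. a n \<in> A) \<and> (\<forall>n. leq (a (Suc n)) (a n)) \<longrightarrow>
        (\<exists>N. \<forall>n\<ge>N.
           has_dev (interval A leq (a (Suc n)) (a n)) leq (Minus_One :: 'b deviation) \<or>
           (\<exists>t :: 'b rel. t <o s \<and> has_dev (interval A leq (a (Suc n)) (a n)) leq (Ordinal t))))"
      unfolding has_dev.simps(2)[of A leq s] by argo
    then obtain a where "(\<forall>n. a n \<in> A) \<and> (\<forall>n. leq (a (Suc n)) (a n))"
      "\<not> (\<exists>N. \<forall>n\<ge>N.
           has_dev (interval A leq (a (Suc n)) (a n)) leq (Minus_One :: 'b deviation) \<or>
           (\<exists>t :: 'b rel. t <o s \<and> has_dev (interval A leq (a (Suc n)) (a n)) leq (Ordinal t)))"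
      unfolding not_all not_imp by (elim exE conjE) (rule that; simp)
    then show thesis using that[of a] by simp
  qed
  obtain N where N: "\<And>n. n \<ge> N \<Longrightarrow>
           has_dev (interval A leq (a (Suc n)) (a n)) leq (Minus_One :: 'b deviation) \<or>
           (\<exists>s :: 'b rel. s <o r \<and> has_dev (interval A leq (a (Suc n)) (a n)) leq (Ordinal s))"
    using ch[of a] a by auto
  obtain n where "n \<ge> N" and
    n: "\<not> (has_dev (interval A leq (a (Suc n)) (a n)) leq (Minus_One :: 'b deviation) \<or>
           (\<exists>t :: 'b rel. t <o s \<and> has_dev (interval A leq (a (Suc n)) (a n)) leq (Ordinal t)))"
    using inf by blast
  define I where "I = interval A leq (a (Suc n)) (a n)"
  obtain u :: "'b rel" where u: "u <o r" "has_dev I leq (Ordinal u)"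
    using N[OF \<open>n \<ge> N\<close>] n unfolding I_def by blast
  have "Well_order u" using u(1) by (auto simp: ordLess_def)
  moreover have "\<not> u <o s" using n u unfolding I_def by blast
  ultimately have "s <o u \<or> s =o u"
    using ws ordLess_or_ordLeq ordLeq_iff_ordLess_or_ordIso by blast
  have trI: "transp_on I leq"
    using 1(2) unfolding I_def interval_def by (auto intro: transp_on_subset)
  from \<open>s <o u \<or> s =o u\<close> show ?case
  proof
    assume "s =o u"
    then have "has_dev I leq (Ordinal s)" using u has_dev_ordIso by blast
    then show ?thesis using a unfolding I_def by blast
  next
    assume "s <o u"
    then obtain c d where cd: "c \<in> I" "d \<in> I" "has_dev (interval I leq c d) leq (Ordinal s)"
      using 1(1)[OF u(1) trI u(2)] by blast
    moreover have "interval I leq c d = interval A leq c d"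
      using cd(1,2) 1(2) a unfolding I_def interval_def by (blast dest: transp_onD)
    ultimately show ?thesis unfolding I_def interval_def by auto
  qed
qed

proposition has_deviationI:
  fixes \<alpha> :: "'b deviation"
  assumes tr: "transp_on A leq"
    and dev: "has_dev A leq \<alpha>"
  shows "has_deviation A leq"
proof (cases \<alpha>)
  case Minus_One
  then have "has_dev A leq (Minus_One :: ('a \<times> 'a) deviation)"
    using dev by (simp add: has_dev.simps)
  then show ?thesis unfolding has_deviation_def by blast
next
  case (Ordinal r)
  then have dev: "has_dev A leq (Ordinal r)" using dev by simp
  then have wo: "Well_order r" by (rule has_dev_Well_order)
  define seg where "seg x = Restr r (underS r x)" for x
  have seg_less: "seg x <o r" if "x \<in> Field r" for x
    unfolding seg_def using wo that by (intro underS_Restr_ordLess) auto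
  have "\<exists>p. has_dev (interval A leq (fst p) (snd p)) leq (Ordinal (seg x))" if "x \<in> Field r" for x
    using has_dev_interval[OF tr dev seg_less[OF that]] by auto
  then obtain f where
    f: "\<And>x. x \<in> Field r \<Longrightarrow> has_dev (interval A leq (fst (f x)) (snd (f x))) leq (Ordinal (seg x))"
    by metis
  have "inj_on f (Field r)"
  proof (rule inj_onI)
    fix x y assume xy: "x \<in> Field r" "y \<in> Field r" "f x = f y"
    then have "seg x =o seg y" using f has_dev_unique by metis
    then have "Restr r (underS r x) \<le>o Restr r (underS r y)"
      "Restr r (underS r y) \<le>o Restr r (underS r x)"
      unfolding seg_def using ordIso_iff_ordLeq by blast+
    moreover have "wo_rel.ofilter r (underS r z)" for z
      using wo by (simp add: wo_rel_def wo_rel.underS_ofilter)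
    ultimately have "underS r x = underS r y"
      using ofilter_subset_ordLeq[OF wo] by blast
    then show "x = y"
      using xy wo wo_rel.TOTALS[of r] unfolding wo_rel_def underS_def by blast
  qed
  then have "r =o dir_image r f" by (rule dir_image_ordIso[OF wo])
  then have "has_dev A leq (Ordinal (dir_image r f))" using dev has_dev_ordIso by blast
  then show ?thesis unfolding has_deviation_def by blast
qed

section \<open>Modules over noncommutative rings and their direct summands\<close>

text \<open>
  The library locale \<open>module\<close> requires a commutative ring of scalars; its axioms are
  restated here for an arbitrary unital ring.
\<close>

locale left_module = R?: ring R + M?: abelian_group M
  for R :: "('r, 'p) ring_scheme" (structure) and M :: "('r, 'm, 'q) module_scheme" (structure) +
  assumes smult_closed [simp, intro]:
      "\<lbrakk>a \<in> carrier R; x \<in> carrier M\<rbrakk> \<Longrightarrow> a \<odot>\<^bsub>M\<^esub> x \<in> carrier M"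
    and smult_l_distr:
      "\<lbrakk>a \<in> carrier R; b \<in> carrier R; x \<in> carrier M\<rbrakk> \<Longrightarrow>
      (a \<oplus> b) \<odot>\<^bsub>M\<^esub> x = a \<odot>\<^bsub>M\<^esub> x \<oplus>\<^bsub>M\<^esub> b \<odot>\<^bsub>M\<^esub> x"
    and smult_r_distr:
      "\<lbrakk>a \<in> carrier R; x \<in> carrier M; y \<in> carrier M\<rbrakk> \<Longrightarrow>
      a \<odot>\<^bsub>M\<^esub> (x \<oplus>\<^bsub>M\<^esub> y) = a \<odot>\<^bsub>M\<^esub> x \<oplus>\<^bsub>M\<^esub> a \<odot>\<^bsub>M\<^esub> y"
    and smult_assoc1:
      "\<lbrakk>a \<in> carrier R; b \<in> carrier R; x \<in> carrier M\<rbrakk> \<Longrightarrow>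
      (a \<otimes> b) \<odot>\<^bsub>M\<^esub> x = a \<odot>\<^bsub>M\<^esub> (b \<odot>\<^bsub>M\<^esub> x)"
    and smult_one [simp]:
      "x \<in> carrier M \<Longrightarrow> \<one> \<odot>\<^bsub>M\<^esub> x = x"

definition direct_summands ::
  "('r, 'p) ring_scheme \<Rightarrow> ('r, 'm, 'q) module_scheme \<Rightarrow> 'm set set" where
  "direct_summands R M =
     {A. submodule A R M \<and>
         (\<exists>B. submodule B R M \<and> A \<inter> B = {\<zero>\<^bsub>M\<^esub>} \<and> A <+>\<^bsub>M\<^esub> B = carrier M)}"

text \<open>Right modules over a ring are left modules over its opposite.\<close>

definition opposite_ring :: "('r, 'p) ring_scheme \<Rightarrow> ('r, 'p) ring_scheme" where
  "opposite_ring R = R\<lparr>mult := \<lambda>a b. b \<otimes>\<^bsub>R\<^esub> a\<rparr>"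

definition left_regular :: "('r, 'p) ring_scheme \<Rightarrow> ('r, 'r) module" where
  "left_regular R =
     \<lparr>carrier = carrier R, mult = mult R, one = one R, zero = zero R, add = add R,
      smult = \<lambda>a x. a \<otimes>\<^bsub>R\<^esub> x\<rparr>"

definition right_regular :: "('r, 'p) ring_scheme \<Rightarrow> ('r, 'r) module" where
  "right_regular R = left_regular (opposite_ring R)"

section \<open>Endomorphism rings and idempotents\<close>

text \<open>
  Endomorphisms are represented by functions that are undefined outside the carrier, so that equal
  endomorphisms are equal functions. The product \<open>f \<otimes> g\<close> is ``first \<open>g\<close>, then \<open>f\<close>''.
\<close>

definition module_endomorphisms ::
  "('r, 'p) ring_scheme \<Rightarrow> ('r, 'm, 'q) module_scheme \<Rightarrow> ('m \<Rightarrow> 'm) set" where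
  "module_endomorphisms R M =
     {f \<in> carrier M \<rightarrow>\<^sub>E carrier M.
        (\<forall>x\<in>carrier M. \<forall>y\<in>carrier M. f (x \<oplus>\<^bsub>M\<^esub> y) = f x \<oplus>\<^bsub>M\<^esub> f y) \<and>
        (\<forall>a\<in>carrier R. \<forall>x\<in>carrier M. f (a \<odot>\<^bsub>M\<^esub> x) = a \<odot>\<^bsub>M\<^esub> f x)}"

definition End_ring ::
  "('r, 'p) ring_scheme \<Rightarrow> ('r, 'm, 'q) module_scheme \<Rightarrow> ('m \<Rightarrow> 'm) ring" where
  "End_ring R M =
     \<lparr>carrier = module_endomorphisms R M,
      mult = compose (carrier M),
      one = (\<lambda>x\<in>carrier M. x),
      zero = (\<lambda>x\<in>carrier M. \<zero>\<^bsub>M\<^esub>),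
      add = (\<lambda>f g. \<lambda>x\<in>carrier M. f x \<oplus>\<^bsub>M\<^esub> g x)\<rparr>"

definition idempotents :: "('e, 'p) ring_scheme \<Rightarrow> 'e set" where
  "idempotents E = {e \<in> carrier E. e \<otimes>\<^bsub>E\<^esub> e = e}"

definition idem_le :: "('e, 'p) ring_scheme \<Rightarrow> 'e \<Rightarrow> 'e \<Rightarrow> bool" where
  "idem_le E e e' \<longleftrightarrow> e \<otimes>\<^bsub>E\<^esub> e' = e \<and> e' \<otimes>\<^bsub>E\<^esub> e = e"

lemma (in ring) ring_opposite_ring: "ring (opposite_ring R)"
proof -
  have "abelian_group (opposite_ring R)"
    by (rule abelian_groupI)
      (auto simp: opposite_ring_def add.m_ac intro: add.l_inv_ex)
  moreover have "monoid (opposite_ring R)"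
    by (rule monoidI) (auto simp: opposite_ring_def m_assoc)
  ultimately show ?thesis
    by (rule ringI) (auto simp: opposite_ring_def l_distr r_distr)
qed

lemma (in ring) left_module_left_regular: "left_module R (left_regular R)"
proof -
  have "abelian_group (left_regular R)"
    by (rule abelian_groupI) (auto simp: left_regular_def add.m_ac intro: add.l_inv_ex)
  then show ?thesis
    by (intro left_module.intro left_module_axioms.intro)
      (auto simp: left_regular_def l_distr r_distr m_assoc ring_axioms)
qed

lemma (in ring) left_module_right_regular: "left_module (opposite_ring R) (right_regular R)"
  unfolding right_regular_def by (rule ring.left_module_left_regular[OF ring_opposite_ring])

lemma (in left_module) smult_zero:
  assumes "a \<in> carrier R"
  shows "a \<odot>\<^bsub>M\<^esub> \<zero>\<^bsub>M\<^esub> = \<zero>\<^bsub>M\<^esub>"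
proof -
  have "a \<odot>\<^bsub>M\<^esub> \<zero>\<^bsub>M\<^esub> = a \<odot>\<^bsub>M\<^esub> \<zero>\<^bsub>M\<^esub> \<oplus>\<^bsub>M\<^esub> a \<odot>\<^bsub>M\<^esub> \<zero>\<^bsub>M\<^esub>"
    using smult_r_distr[OF assms M.zero_closed M.zero_closed] by simp
  then show ?thesis using assms M.add.r_cancel_one' smult_closed M.zero_closed by metis
qed

lemma (in left_module) smult_uminus:
  assumes "a \<in> carrier R" "x \<in> carrier M"
  shows "a \<odot>\<^bsub>M\<^esub> (\<ominus>\<^bsub>M\<^esub> x) = \<ominus>\<^bsub>M\<^esub> (a \<odot>\<^bsub>M\<^esub> x)"
proof -
  have "a \<odot>\<^bsub>M\<^esub> (\<ominus>\<^bsub>M\<^esub> x) \<oplus>\<^bsub>M\<^esub> a \<odot>\<^bsub>M\<^esub> x = \<zero>\<^bsub>M\<^esub>"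
    using smult_r_distr[of a "\<ominus>\<^bsub>M\<^esub> x" x] assms by (simp add: M.l_neg smult_zero)
  then show ?thesis using assms by (simp add: M.minus_equality)
qed

lemma (in left_module) ring_End_ring: "ring (End_ring R M)"
proof -
  let ?E = "module_endomorphisms R M" and ?add = "\<lambda>f g. \<lambda>x\<in>carrier M. f x \<oplus>\<^bsub>M\<^esub> g x"
  have closed: "f x \<in> carrier M" if "f \<in> ?E" "x \<in> carrier M" for f x
    using that by (auto simp: module_endomorphisms_def)
  have hom: "f (x \<oplus>\<^bsub>M\<^esub> y) = f x \<oplus>\<^bsub>M\<^esub> f y" if "f \<in> ?E" "x \<in> carrier M" "y \<in> carrier M" for f x y
    using that by (auto simp: module_endomorphisms_def)
  have lin: "f (a \<odot>\<^bsub>M\<^esub> x) = a \<odot>\<^bsub>M\<^esub> f x" if "f \<in> ?E" "a \<in> carrier R" "x \<in> carrier M" for f a x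
    using that by (auto simp: module_endomorphisms_def)
  have ext: "f = g" if "f \<in> ?E" "g \<in> ?E" "\<And>x. x \<in> carrier M \<Longrightarrow> f x = g x" for f g
    using that unfolding module_endomorphisms_def by (auto intro: PiE_ext)
  have memI: "(\<lambda>x\<in>carrier M. f x) \<in> ?E"
    if "\<And>x. x \<in> carrier M \<Longrightarrow> f x \<in> carrier M"
      "\<And>x y. x \<in> carrier M \<Longrightarrow> y \<in> carrier M \<Longrightarrow> f (x \<oplus>\<^bsub>M\<^esub> y) = f x \<oplus>\<^bsub>M\<^esub> f y"
      "\<And>a x. a \<in> carrier R \<Longrightarrow> x \<in> carrier M \<Longrightarrow> f (a \<odot>\<^bsub>M\<^esub> x) = a \<odot>\<^bsub>M\<^esub> f x" for f
    using that by (simp add: module_endomorphisms_def)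
  have add: "?add f g \<in> ?E" if "f \<in> ?E" "g \<in> ?E" for f g
    by (rule memI) (simp_all add: that closed hom lin smult_r_distr M.add.m_ac)
  have mult: "compose (carrier M) f g \<in> ?E" if "f \<in> ?E" "g \<in> ?E" for f g
    unfolding compose_def by (rule memI) (simp_all add: that closed hom lin)
  have zero: "(\<lambda>x\<in>carrier M. \<zero>\<^bsub>M\<^esub>) \<in> ?E" and one: "(\<lambda>x\<in>carrier M. x) \<in> ?E"
    by (rule memI; simp add: smult_zero)+
  have uminus: "(\<lambda>x\<in>carrier M. \<ominus>\<^bsub>M\<^esub> f x) \<in> ?E" if "f \<in> ?E" for f
    by (rule memI) (simp_all add: that closed hom lin smult_uminus M.minus_add)
  have "abelian_group (End_ring R M)"
  proof (rule abelian_groupI)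
    fix f assume "f \<in> carrier (End_ring R M)"
    then have f: "f \<in> ?E" by (simp add: End_ring_def)
    have "?add (\<lambda>x\<in>carrier M. \<ominus>\<^bsub>M\<^esub> f x) f = (\<lambda>x\<in>carrier M. \<zero>\<^bsub>M\<^esub>)"
      using f closed by (auto simp: M.l_neg)
    then show "\<exists>g\<in>carrier (End_ring R M). g \<oplus>\<^bsub>End_ring R M\<^esub> f = \<zero>\<^bsub>End_ring R M\<^esub>"
      using uminus[OF f] unfolding End_ring_def by (intro bexI) simp_all
  qed (auto simp: End_ring_def add zero closed hom lin smult_r_distr smult_zero M.add.m_ac
      intro!: ext memI)
  moreover have "monoid (End_ring R M)"
    by (rule monoidI)
      (auto simp: End_ring_def mult one closed hom lin compose_def intro!: ext memI)
  ultimately show ?thesis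
    by (rule ringI)
      (auto simp: End_ring_def add mult closed hom lin smult_r_distr compose_def M.add.m_ac
        intro!: ext memI)
qed

end

theory Submission
  imports Defs
begin

text \<open>
  All five posets are compared with the idempotents of \<open>E = End M\<close>. Sending an idempotent to the
  direct summand that it projects onto is monotone and surjective. It is far from injective,
  because a summand has many complements, but it is injective on comparable pairs: if
  \<open>e \<le> e'\<close> have the same image then \<open>e = e'\<close>. Moreover it lifts inside intervals: if \<open>e \<le> e'\<close> and
  \<open>A\<close> is a summand between the images of \<open>e\<close> and \<open>e'\<close>, then the complement of \<open>A\<close> can be chosen
  between those of \<open>e'\<close> and \<open>e\<close>, which yields an idempotent in \<open>[e, e']\<close> with image \<open>A\<close>
  (\<open>idempotent_lifting\<close>). These properties let descending chains be transported in both
  directions, and they pass to subintervals, so well-founded induction on the ordinal shows that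
  such a map preserves the deviation exactly (\<open>has_dev_interval_lifting\<close>).

  The lifting argument sees a summand only through the preorder that its inclusions induce on the
  idempotents. For \<open>_EE\<close> and the summands \<open>Ee\<close> this preorder is \<open>ef = e\<close>; for \<open>E_E\<close> with \<open>eE\<close>,
  and for \<open>M\<close> with \<open>eM\<close>, it is \<open>fe = e\<close>, which is the former preorder in the opposite ring.
  Hence one computation in an arbitrary ring serves all three (\<open>has_dev_idempotent_preorder\<close>).
  The dual of the poset of idempotents is isomorphic to the poset itself by \<open>e \<mapsto> 1 - e\<close>.
\<close>

section \<open>Deviation along interval-lifting maps\<close>

lemma transp_on_subseteq: "transp_on A (\<subseteq>)"
  by (rule transp_onI) blast

text \<open>
  A descending chain in the target lifts term by term: each new term lies between the image of
  \<open>a\<close> and that of the last lifted term, so the lifting property applies to this smaller interval.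
  Since an interval of an interval is an interval, the claim for all pairs \<open>a\<close>, \<open>b\<close> at once
  is suitable for induction on the ordinal.
\<close>

lemma has_dev_interval_lifting:
  fixes \<alpha> :: "'c deviation"
  assumes trP: "transp_on P leqP" and trQ: "transp_on Q leqQ"
    and pQ: "\<And>x. x \<in> P \<Longrightarrow> p x \<in> Q"
    and mono: "\<And>x y. x \<in> P \<Longrightarrow> y \<in> P \<Longrightarrow> leqP x y \<Longrightarrow> leqQ (p x) (p y)"
    and strict: "\<And>x y. x \<in> P \<Longrightarrow> y \<in> P \<Longrightarrow> leqP x y \<Longrightarrow> p x = p y \<Longrightarrow> x = y"
    and lift: "\<And>x y z. x \<in> P \<Longrightarrow> y \<in> P \<Longrightarrow> leqP x y \<Longrightarrow> z \<in> Q \<Longrightarrow>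
      leqQ (p x) z \<Longrightarrow> leqQ z (p y) \<Longrightarrow> \<exists>w\<in>P. leqP x w \<and> leqP w y \<and> p w = z"
    and "a \<in> P" "b \<in> P" "leqP a b"
  shows "has_dev (interval P leqP a b) leqP \<alpha> \<longleftrightarrow>
    has_dev (interval Q leqQ (p a) (p b)) leqQ \<alpha>"
proof -
  have nestP: "interval (interval P leqP a b) leqP c d = interval P leqP c d"
    if "a \<in> P" "b \<in> P" "c \<in> interval P leqP a b" "d \<in> interval P leqP a b" for a b c d
    using that trP unfolding interval_def by (blast dest: transp_onD)
  have nestQ: "interval (interval Q leqQ a b) leqQ c d = interval Q leqQ c d"
    if "a \<in> Q" "b \<in> Q" "c \<in> interval Q leqQ a b" "d \<in> interval Q leqQ a b" for a b c d
    using that trQ unfolding interval_def by (blast dest: transp_onD)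
  have p_interval: "p x \<in> interval Q leqQ (p a) (p b)"
    if "a \<in> P" "b \<in> P" "x \<in> interval P leqP a b" for a b x
    using that mono pQ by (auto simp: interval_def)
  have lift_below: "\<exists>w\<in>interval P leqP a b. leqP w x \<and> p w = z"
    if "a \<in> P" "b \<in> P" "x \<in> interval P leqP a b"
      "z \<in> interval Q leqQ (p a) (p b)" "leqQ z (p x)" for a b x z
    using that lift[of a x z] trP unfolding interval_def by (blast dest: transp_onD)
  have lift_interval: "\<exists>w\<in>interval P leqP a b. p w = z"
    if "a \<in> P" "b \<in> P" "leqP a b" "z \<in> interval Q leqQ (p a) (p b)" for a b z
    using that lift[of a b z] unfolding interval_def by blast
  have discrete: "has_dev (interval P leqP a b) leqP (Minus_One :: 'c deviation) \<longleftrightarrow>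
      has_dev (interval Q leqQ (p a) (p b)) leqQ (Minus_One :: 'c deviation)" (is "?L \<longleftrightarrow> ?R")
    if ab: "a \<in> P" "b \<in> P" "leqP a b" for a b
  proof
    assume L: ?L
    show ?R unfolding has_dev.simps
    proof (intro ballI impI)
      fix y z assume yz: "y \<in> interval Q leqQ (p a) (p b)" "z \<in> interval Q leqQ (p a) (p b)"
        "leqQ y z"
      obtain w where w: "w \<in> interval P leqP a b" "p w = z"
        using lift_interval[OF ab yz(2)] by blast
      obtain v where "v \<in> interval P leqP a b" "leqP v w" "p v = y"
        using lift_below[OF ab(1,2) w(1) yz(1)] yz(3) w(2) by blast
      then show "y = z" using L w unfolding has_dev.simps by blast
    qed
  next
    assume R: ?R
    show ?L unfolding has_dev.simps
    proof (intro ballI impI)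
      fix x y assume xy: "x \<in> interval P leqP a b" "y \<in> interval P leqP a b" "leqP x y"
      then have in_P: "x \<in> P" "y \<in> P" by (auto simp: interval_def)
      have "p x = p y"
        using R p_interval[OF ab(1,2)] xy mono[OF in_P xy(3)] unfolding has_dev.simps by blast
      then show "x = y" using strict in_P xy(3) by blast
    qed
  qed
  have ordinal: "has_dev (interval P leqP a b) leqP (Ordinal r) \<longleftrightarrow>
      has_dev (interval Q leqQ (p a) (p b)) leqQ (Ordinal r)"
    if "a \<in> P" "b \<in> P" "leqP a b" for a b and r :: "'c rel"
    using that
  proof (induction r arbitrary: a b rule: wf_induct_rule[OF wf_ordLess])
    case (1 r)
    note ab = 1(2-4)
    let ?P = "interval P leqP a b" and ?Q = "interval Q leqQ (p a) (p b)"
    let ?smallP = "\<lambda>c d. has_dev (interval ?P leqP c d) leqP (Minus_One :: 'c deviation) \<or>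
        (\<exists>s :: 'c rel. s <o r \<and> has_dev (interval ?P leqP c d) leqP (Ordinal s))"
    let ?smallQ = "\<lambda>c d. has_dev (interval ?Q leqQ c d) leqQ (Minus_One :: 'c deviation) \<or>
        (\<exists>s :: 'c rel. s <o r \<and> has_dev (interval ?Q leqQ c d) leqQ (Ordinal s))"
    have small: "?smallP c d \<longleftrightarrow> ?smallQ (p c) (p d)" if "c \<in> ?P" "d \<in> ?P" "leqP c d" for c d
    proof -
      have "c \<in> P" "d \<in> P" using that by (auto simp: interval_def)
      then show ?thesis
        unfolding nestP[OF ab(1,2) that(1,2)]
          nestQ[OF pQ[OF ab(1)] pQ[OF ab(2)] p_interval[OF ab(1,2) that(1)] p_interval[OF ab(1,2) that(2)]]
        using discrete[OF _ _ that(3)] 1(1)[OF _ _ _ that(3)] by blast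
    qed
    have chains: "(\<forall>x :: nat \<Rightarrow> _. (\<forall>n. x n \<in> ?P) \<and> (\<forall>n. leqP (x (Suc n)) (x n)) \<longrightarrow>
          (\<exists>N. \<forall>n\<ge>N. ?smallP (x (Suc n)) (x n))) \<longleftrightarrow>
        (\<forall>y :: nat \<Rightarrow> _. (\<forall>n. y n \<in> ?Q) \<and> (\<forall>n. leqQ (y (Suc n)) (y n)) \<longrightarrow>
          (\<exists>N. \<forall>n\<ge>N. ?smallQ (y (Suc n)) (y n)))" (is "?L \<longleftrightarrow> ?R")
    proof
      assume L: ?L
      show ?R
      proof (intro allI impI, elim conjE)
        fix y :: "nat \<Rightarrow> _" assume y: "\<forall>n. y n \<in> ?Q" "\<forall>n. leqQ (y (Suc n)) (y n)"
        have "\<exists>x. \<forall>n. (x n \<in> ?P \<and> p (x n) = y n) \<and> leqP (x (Suc n)) (x n)"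
        proof (rule dependent_nat_choice)
          show "\<exists>x. x \<in> ?P \<and> p x = y 0" using lift_interval[OF ab] y(1) by blast
        next
          fix x n assume "x \<in> ?P \<and> p x = y n"
          then show "\<exists>w. (w \<in> ?P \<and> p w = y (Suc n)) \<and> leqP w x"
            using lift_below[OF ab(1,2), of x "y (Suc n)"] y by auto
        qed
        then obtain x where x: "\<And>n. x n \<in> ?P" "\<And>n. p (x n) = y n" "\<And>n. leqP (x (Suc n)) (x n)"
          by blast
        then obtain N where "\<forall>n\<ge>N. ?smallP (x (Suc n)) (x n)" using L by meson
        then have "\<forall>n\<ge>N. ?smallQ (p (x (Suc n))) (p (x n))"
          using small[OF x(1) x(1) x(3)] by blast
        then show "\<exists>N. \<forall>n\<ge>N. ?smallQ (y (Suc n)) (y n)" unfolding x(2) by blast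
      qed
    next
      assume R: ?R
      show ?L
      proof (intro allI impI, elim conjE)
        fix x :: "nat \<Rightarrow> _" assume x: "\<forall>n. x n \<in> ?P" "\<forall>n. leqP (x (Suc n)) (x n)"
        then have in_P: "x n \<in> P" for n by (auto simp: interval_def)
        have "(\<forall>n. p (x n) \<in> ?Q) \<and> (\<forall>n. leqQ (p (x (Suc n))) (p (x n)))"
          using p_interval[OF ab(1,2)] mono[OF in_P in_P] x by blast
        then obtain N where "\<forall>n\<ge>N. ?smallQ (p (x (Suc n))) (p (x n))"
          using R[THEN spec, of "\<lambda>n. p (x n)"] by blast
        then show "\<exists>N. \<forall>n\<ge>N. ?smallP (x (Suc n)) (x n)"
          using small[OF x(1)[rule_format] x(1)[rule_format] x(2)[rule_format]] by blast
      qed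
    qed
    have least: "(\<forall>s :: 'c rel. s <o r \<longrightarrow> \<not> has_dev ?P leqP (Ordinal s)) \<longleftrightarrow>
        (\<forall>s :: 'c rel. s <o r \<longrightarrow> \<not> has_dev ?Q leqQ (Ordinal s))"
      using 1(1)[OF _ ab] by blast
    show ?case
      unfolding has_dev.simps(2)[of ?P leqP r] has_dev.simps(2)[of ?Q leqQ r]
        discrete[OF ab] least chains by (rule refl)
  qed
  show ?thesis
    using discrete ordinal assms(7-9) by (cases \<alpha>) auto
qed

section \<open>Submodules\<close>

context left_module
begin

lemma submoduleD:
  assumes "submodule A R M"
  shows "A \<subseteq> carrier M" "\<zero>\<^bsub>M\<^esub> \<in> A"
    "\<And>x y. x \<in> A \<Longrightarrow> y \<in> A \<Longrightarrow> x \<oplus>\<^bsub>M\<^esub> y \<in> A"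
    "\<And>x. x \<in> A \<Longrightarrow> \<ominus>\<^bsub>M\<^esub> x \<in> A"
    "\<And>a x. a \<in> carrier R \<Longrightarrow> x \<in> A \<Longrightarrow> a \<odot>\<^bsub>M\<^esub> x \<in> A"
  using subgroup.subset[OF submodule.axioms(1)[OF assms]]
    subgroup.one_closed[OF submodule.axioms(1)[OF assms]]
    subgroup.m_closed[OF submodule.axioms(1)[OF assms]]
    subgroup.m_inv_closed[OF submodule.axioms(1)[OF assms]]
    submodule.smult_closed[OF assms]
  by (simp_all add: a_inv_def)

lemma submodule_direct_sum_cancel:
  assumes A: "submodule A R M" and B: "submodule B R M" and int: "A \<inter> B = {\<zero>\<^bsub>M\<^esub>}"
    and a: "a \<in> A" "a' \<in> A" and b: "b \<in> B" "b' \<in> B"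
    and eq: "a \<oplus>\<^bsub>M\<^esub> b = a' \<oplus>\<^bsub>M\<^esub> b'"
  shows "a = a'"
proof -
  have car: "a \<in> carrier M" "a' \<in> carrier M" "b \<in> carrier M" "b' \<in> carrier M"
    using a b submoduleD(1)[OF A] submoduleD(1)[OF B] by auto
  have "\<ominus>\<^bsub>M\<^esub> a' \<oplus>\<^bsub>M\<^esub> a = (\<ominus>\<^bsub>M\<^esub> a' \<oplus>\<^bsub>M\<^esub> (a \<oplus>\<^bsub>M\<^esub> b)) \<oplus>\<^bsub>M\<^esub> \<ominus>\<^bsub>M\<^esub> b"
    using car by (simp add: M.a_assoc M.r_neg)
  also have "\<dots> = b' \<oplus>\<^bsub>M\<^esub> \<ominus>\<^bsub>M\<^esub> b"
    unfolding eq using car by (simp add: M.r_neg1)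
  finally have diff: "\<ominus>\<^bsub>M\<^esub> a' \<oplus>\<^bsub>M\<^esub> a = b' \<oplus>\<^bsub>M\<^esub> \<ominus>\<^bsub>M\<^esub> b" .
  moreover have "\<ominus>\<^bsub>M\<^esub> a' \<oplus>\<^bsub>M\<^esub> a \<in> A" "b' \<oplus>\<^bsub>M\<^esub> \<ominus>\<^bsub>M\<^esub> b \<in> B"
    using a b submoduleD[OF A] submoduleD[OF B] by auto
  ultimately have "\<ominus>\<^bsub>M\<^esub> a' \<oplus>\<^bsub>M\<^esub> a = \<zero>\<^bsub>M\<^esub>" using int by auto
  then have "a' \<oplus>\<^bsub>M\<^esub> (\<ominus>\<^bsub>M\<^esub> a' \<oplus>\<^bsub>M\<^esub> a) = a'" using car by simp
  then show "a = a'" using car by (simp add: M.r_neg2)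
qed

end

section \<open>Idempotents\<close>

context ring
begin

lemma transp_on_idem_le: "transp_on (idempotents R) (idem_le R)"
proof (rule transp_onI)
  fix e f g
  assume efg: "e \<in> idempotents R" "f \<in> idempotents R" "g \<in> idempotents R"
    and le: "idem_le R e f" "idem_le R f g"
  have car: "e \<in> carrier R" "f \<in> carrier R" "g \<in> carrier R"
    using efg by (auto simp: idempotents_def)
  have "e \<otimes> g = e \<otimes> (f \<otimes> g)" "g \<otimes> e = (g \<otimes> f) \<otimes> e"
    using le car m_assoc[of e f g] m_assoc[of g f e] by (auto simp: idem_le_def)
  then show "idem_le R e g" using le by (auto simp: idem_le_def)
qed

text \<open>
  In terms of left ideals, this lifts \<open>Ee \<subseteq> Ef \<subseteq> Ee'\<close> to idempotents \<open>e \<le> h \<le> e'\<close> with \<open>Eh = Ef\<close>.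
  The witness is \<open>h = g + (e - ge)\<close> with \<open>g = e'f\<close>. Multiplying by \<open>e'\<close> on the left places the
  idempotent \<open>g\<close> below \<open>e'\<close> without changing the left ideal. The correction
  \<open>e - ge = (1 - g) e g\<close> is of the form \<open>(1 - g) x g\<close>: adding such an element to \<open>g\<close> gives exactly
  the idempotents that generate the same left ideal, and \<open>x = e\<close> is the choice that makes
  \<open>he = ge + (e - ge) = e\<close>.
\<close>

lemma idempotent_lifting:
  assumes "e \<in> idempotents R" "e' \<in> idempotents R" "f \<in> idempotents R"
    and le: "idem_le R e e'" and ef: "e \<otimes> f = e" and fe': "f \<otimes> e' = f"
  shows "\<exists>h\<in>idempotents R. idem_le R e h \<and> idem_le R h e' \<and> h \<otimes> f = h \<and> f \<otimes> h = f"
proof -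
  have car: "e \<in> carrier R" "e' \<in> carrier R" "f \<in> carrier R"
    and idem: "e \<otimes> e = e" "e' \<otimes> e' = e'" "f \<otimes> f = f"
    using assms by (auto simp: idempotents_def)
  have ee': "e \<otimes> e' = e" "e' \<otimes> e = e" using le by (auto simp: idem_le_def)
  define g where "g = e' \<otimes> f"
  have g: "g \<in> carrier R" using car by (simp add: g_def)
  have eg: "e \<otimes> g = e"
    using m_assoc[of e e' f] car ee' ef by (simp add: g_def)
  have e'g: "e' \<otimes> g = g"
    using m_assoc[of e' e' f] car idem by (simp add: g_def)
  have ge': "g \<otimes> e' = g" and gf: "g \<otimes> f = g"
    using car idem fe' by (simp_all add: g_def m_assoc)
  have fg: "f \<otimes> g = f"
    using m_assoc[of f e' f] car idem fe' by (simp add: g_def)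
  define h where "h = g \<oplus> (e \<ominus> g \<otimes> e)"
  have h: "h \<in> carrier R" using car g by (simp add: h_def)
  have r: "x \<otimes> h = x \<otimes> g \<oplus> (x \<otimes> e \<ominus> x \<otimes> g \<otimes> e)" if "x \<in> carrier R" for x
    using that car g by (simp add: h_def a_minus_def r_distr r_minus m_assoc)
  have l: "h \<otimes> x = g \<otimes> x \<oplus> (e \<otimes> x \<ominus> g \<otimes> (e \<otimes> x))" if "x \<in> carrier R" for x
    using that car g by (simp add: h_def a_minus_def l_distr l_minus m_assoc)
  have eh: "e \<otimes> h = e" and fh: "f \<otimes> h = f" and e'h: "e' \<otimes> h = h"
    using car g by (simp_all add: r eg fg e'g ee' idem) (simp_all add: a_minus_def r_neg h_def)
  have he: "h \<otimes> e = e"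
    using car g by (simp add: l idem a_minus_def a_lcomm r_neg)
  have hf: "h \<otimes> f = h" and he': "h \<otimes> e' = h"
    using car g by (simp_all add: l ef gf ge' ee') (simp_all add: h_def)
  have "h \<otimes> h = h"
    using m_assoc[OF h car(3) h] hf fh by simp
  then show ?thesis
    using h eh he e'h he' hf fh by (auto simp: idempotents_def idem_le_def)
qed

text \<open>
  The family \<open>Q\<close> of sets stands for the summands of a module. As \<open>0\<close> and \<open>1\<close> are the least and the
  greatest idempotent, both posets are themselves intervals, and the comparison of intervals
  applies to them.
\<close>

lemma has_dev_idempotent_preorder:
  fixes \<alpha> :: "'c deviation"
  assumes surj: "p ` idempotents R = Q"
    and p: "\<And>e f. e \<in> idempotents R \<Longrightarrow> f \<in> idempotents R \<Longrightarrow> p e \<subseteq> p f \<longleftrightarrow> e \<otimes> f = e"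
  shows "has_dev Q (\<subseteq>) \<alpha> \<longleftrightarrow> has_dev (idempotents R) (idem_le R) \<alpha>"
proof -
  have car: "e \<in> carrier R" if "e \<in> idempotents R" for e
    using that by (simp add: idempotents_def)
  have bounds: "\<zero> \<in> idempotents R" "\<one> \<in> idempotents R"
    by (simp_all add: idempotents_def)
  have P: "interval (idempotents R) (idem_le R) \<zero> \<one> = idempotents R"
    using car by (auto simp: interval_def idem_le_def)
  have "p \<zero> \<subseteq> p e" "p e \<subseteq> p \<one>" if "e \<in> idempotents R" for e
    using that bounds car by (simp_all add: p)
  then have Q: "interval Q (\<subseteq>) (p \<zero>) (p \<one>) = Q"
    unfolding interval_def surj[symmetric] by blast
  have "has_dev (interval (idempotents R) (idem_le R) \<zero> \<one>) (idem_le R) \<alpha> \<longleftrightarrow>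
      has_dev (interval Q (\<subseteq>) (p \<zero>) (p \<one>)) (\<subseteq>) \<alpha>"
  proof (rule has_dev_interval_lifting[OF transp_on_idem_le])
    show "transp_on Q (\<subseteq>)" by (rule transp_on_subseteq)
  next
    fix e assume "e \<in> idempotents R" then show "p e \<in> Q" using surj by blast
  next
    fix e f assume ef: "e \<in> idempotents R" "f \<in> idempotents R" "idem_le R e f"
    then show "p e \<subseteq> p f" by (simp add: p idem_le_def)
    assume "p e = p f"
    then have "f \<otimes> e = f" using p[of f e] ef by simp
    then show "e = f" using ef by (simp add: idem_le_def)
  next
    fix e e' A
    assume e: "e \<in> idempotents R" "e' \<in> idempotents R" "idem_le R e e'"
      and A: "A \<in> Q" "p e \<subseteq> A" "A \<subseteq> p e'"
    obtain f where f: "f \<in> idempotents R" "A = p f" using A(1) surj by blast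
    then obtain h where h: "h \<in> idempotents R" "idem_le R e h" "idem_le R h e'"
      "h \<otimes> f = h" "f \<otimes> h = f"
      using idempotent_lifting[OF e(1,2) f(1) e(3)] A e p by auto
    then have "p h = A" using p[of h f] p[of f h] f by auto
    then show "\<exists>h\<in>idempotents R. idem_le R e h \<and> idem_le R h e' \<and> p h = A" using h by blast
  next
    show "\<zero> \<in> idempotents R" "\<one> \<in> idempotents R" by fact+
    show "idem_le R \<zero> \<one>" by (simp add: idem_le_def)
  qed
  then show ?thesis unfolding P Q by blast
qed

lemma complement_idempotent:
  assumes "e \<in> idempotents R"
  shows "\<one> \<ominus> e \<in> idempotents R" "\<one> \<ominus> (\<one> \<ominus> e) = e"
proof -
  have e: "e \<in> carrier R" "e \<otimes> e = e" using assms by (auto simp: idempotents_def)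
  then show "\<one> \<ominus> e \<in> idempotents R"
    by (simp add: idempotents_def a_minus_def l_distr r_distr l_minus r_minus minus_add
        a_assoc l_neg r_neg)
  show "\<one> \<ominus> (\<one> \<ominus> e) = e"
    using e by (simp add: a_minus_def minus_add a_assoc[symmetric] r_neg)
qed

lemma idem_le_complement:
  assumes "e \<in> carrier R" "f \<in> carrier R" "idem_le R e f"
  shows "idem_le R (\<one> \<ominus> f) (\<one> \<ominus> e)"
proof -
  have "\<ominus> e \<oplus> (\<ominus> f \<oplus> e) = \<ominus> f"
    using assms a_lcomm[of "\<ominus> e" "\<ominus> f" e] by (simp add: l_neg)
  then show ?thesis
    using assms
    by (simp add: idem_le_def a_minus_def l_distr r_distr l_minus r_minus minus_add a_assoc r_neg l_neg)
qed

lemma has_dev_dual_idempotents: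
  fixes \<alpha> :: "'c deviation"
  shows "has_dev (idempotents R) (\<lambda>e e'. idem_le R e' e) \<alpha> \<longleftrightarrow>
    has_dev (idempotents R) (idem_le R) \<alpha>"
proof -
  have car: "e \<in> carrier R" if "e \<in> idempotents R" for e
    using that by (simp add: idempotents_def)
  have bounds: "\<zero> \<in> idempotents R" "\<one> \<in> idempotents R"
    by (simp_all add: idempotents_def)
  have P: "interval (idempotents R) (\<lambda>e e'. idem_le R e' e) \<one> \<zero> = idempotents R"
    "interval (idempotents R) (idem_le R) (\<one> \<ominus> \<one>) (\<one> \<ominus> \<zero>) = idempotents R"
    using car by (auto simp: interval_def idem_le_def a_minus_def r_neg)
  have "has_dev (interval (idempotents R) (\<lambda>e e'. idem_le R e' e) \<one> \<zero>) (\<lambda>e e'. idem_le R e' e) \<alpha> \<longleftrightarrow>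
      has_dev (interval (idempotents R) (idem_le R) (\<one> \<ominus> \<one>) (\<one> \<ominus> \<zero>)) (idem_le R) \<alpha>"
  proof (rule has_dev_interval_lifting[OF _ transp_on_idem_le])
    show "transp_on (idempotents R) (\<lambda>e e'. idem_le R e' e)"
      using transp_on_idem_le unfolding transp_on_def by blast
  next
    fix e f assume "e \<in> idempotents R" "f \<in> idempotents R" "\<one> \<ominus> e = \<one> \<ominus> f"
    then show "e = f" using complement_idempotent(2) by metis
  next
    fix e f g
    assume "e \<in> idempotents R" "f \<in> idempotents R" "g \<in> idempotents R"
      "idem_le R (\<one> \<ominus> e) g" "idem_le R g (\<one> \<ominus> f)"
    then show "\<exists>h\<in>idempotents R. idem_le R h e \<and> idem_le R f h \<and> \<one> \<ominus> h = g"
      using idem_le_complement[of "\<one> \<ominus> e" g] idem_le_complement[of g "\<one> \<ominus> f"]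
        complement_idempotent car by (intro bexI[of _ "\<one> \<ominus> g"]) auto
  next
    show "idem_le R \<zero> \<one>" by (simp add: idem_le_def)
  qed (use bounds complement_idempotent idem_le_complement car in auto)
  then show ?thesis unfolding P .
qed

section \<open>Summands of the regular module\<close>

text \<open>
  The summand \<open>Ee\<close> is written as \<open>{x. xe = x}\<close>, so that inclusion of summands becomes an equation
  between idempotents. Conversely, if \<open>E = A \<oplus> B\<close> then the \<open>A\<close>-component of \<open>1\<close> is an idempotent
  that generates \<open>A\<close>.
\<close>

lemma has_dev_left_regular:
  fixes \<alpha> :: "'c deviation"
  shows "has_dev (direct_summands R (left_regular R)) (\<subseteq>) \<alpha> \<longleftrightarrow>
    has_dev (idempotents R) (idem_le R) \<alpha>"
proof (rule has_dev_idempotent_preorder)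
  let ?p = "\<lambda>e. {x \<in> carrier R. x \<otimes> e = x}"
  interpret L: left_module R "left_regular R" by (rule left_module_left_regular)
  have zero: "\<zero>\<^bsub>left_regular R\<^esub> = \<zero>" and carr: "carrier (left_regular R) = carrier R"
    by (simp_all add: left_regular_def)
  have submodule_p: "submodule (?p e) R (left_regular R)" if "e \<in> carrier R" for e
  proof (intro submodule.intro subgroup.intro submodule_axioms.intro)
    fix x assume "x \<in> ?p e"
    moreover have "inv\<^bsub>add_monoid (left_regular R)\<^esub> x = \<ominus> x"
      by (simp add: left_regular_def a_inv_def m_inv_def)
    ultimately show "inv\<^bsub>add_monoid (left_regular R)\<^esub> x \<in> ?p e"
      using that by (simp add: l_minus)
  qed (use that in \<open>auto simp: left_regular_def l_distr m_assoc\<close>)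
  have summand: "?p e \<in> direct_summands R (left_regular R)" if "e \<in> idempotents R" for e
  proof -
    have e: "e \<in> carrier R" "e \<otimes> e = e" using that by (auto simp: idempotents_def)
    have "?p e \<inter> ?p (\<one> \<ominus> e) = {\<zero>}"
      using e by (auto simp: a_minus_def r_distr r_minus r_neg)
    moreover have "?p e <+>\<^bsub>left_regular R\<^esub> ?p (\<one> \<ominus> e) = carrier R"
    proof -
      have "x = x \<otimes> e \<oplus> x \<otimes> (\<one> \<ominus> e)" if "x \<in> carrier R" for x
        using e that by (simp add: a_minus_def r_distr r_minus a_lcomm r_neg)
      moreover have "x \<otimes> e \<in> ?p e" "x \<otimes> (\<one> \<ominus> e) \<in> ?p (\<one> \<ominus> e)" if "x \<in> carrier R" for x
        using e that complement_idempotent(1)[OF \<open>e \<in> idempotents R\<close>]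
        by (auto simp: m_assoc idempotents_def)
      ultimately show ?thesis
        by (auto simp: left_regular_def set_add_def set_mult_def) blast
    qed
    ultimately show ?thesis
      using submodule_p[of e] submodule_p[of "\<one> \<ominus> e"] e
      unfolding direct_summands_def by (auto simp: left_regular_def)
  qed
  have generated: "\<exists>e\<in>idempotents R. A = ?p e"
    if summ: "A \<in> direct_summands R (left_regular R)" for A
  proof -
    obtain B where A: "submodule A R (left_regular R)" and B: "submodule B R (left_regular R)"
      and int: "A \<inter> B = {\<zero>}" and sum: "A <+>\<^bsub>left_regular R\<^esub> B = carrier R"
      using summ unfolding direct_summands_def mem_Collect_eq zero carr by blast
    have sub: "C \<subseteq> carrier R" "\<zero> \<in> C" "\<And>a x. a \<in> carrier R \<Longrightarrow> x \<in> C \<Longrightarrow> a \<otimes> x \<in> C"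
      if "submodule C R (left_regular R)" for C
      using L.submoduleD[OF that] by (auto simp: left_regular_def)
    have "\<one> \<in> A <+>\<^bsub>left_regular R\<^esub> B" using sum by simp
    then obtain e f where ef: "e \<in> A" "f \<in> B" "\<one> = e \<oplus> f"
      by (auto simp: left_regular_def set_add_def set_mult_def)
    then have car: "e \<in> carrier R" "f \<in> carrier R" using sub(1)[OF A] sub(1)[OF B] by auto
    have fixed: "x \<otimes> e = x" if x: "x \<in> A" for x
    proof -
      have xc: "x \<in> carrier R" using x sub(1)[OF A] by auto
      have "x = x \<otimes> e \<oplus> x \<otimes> f" using xc car r_distr[of e f x] unfolding ef(3)[symmetric] by simp
      then have "x \<otimes> e \<oplus>\<^bsub>left_regular R\<^esub> x \<otimes> f = x \<oplus>\<^bsub>left_regular R\<^esub> \<zero>"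
        using xc by (simp add: left_regular_def)
      from L.submodule_direct_sum_cancel[OF A B _ _ _ _ _ this]
      show ?thesis using int zero sub[OF A] sub[OF B] x xc ef(1,2) by simp
    qed
    moreover have "x \<in> A" if "x \<in> carrier R" "x \<otimes> e = x" for x
      using sub(3)[OF A that(1) ef(1)] that(2) by simp
    ultimately have "A = ?p e" using sub(1)[OF A] by blast
    moreover have "e \<in> idempotents R" using fixed[OF ef(1)] car by (simp add: idempotents_def)
    ultimately show ?thesis by blast
  qed
  show "?p ` idempotents R = direct_summands R (left_regular R)"
    using summand generated by (auto simp: image_iff)
  show "?p e \<subseteq> ?p f \<longleftrightarrow> e \<otimes> f = e" if "e \<in> idempotents R" "f \<in> idempotents R" for e f
  proof
    assume "?p e \<subseteq> ?p f"
    then show "e \<otimes> f = e" using that by (auto simp: idempotents_def)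
  next
    assume ef: "e \<otimes> f = e"
    have "x \<otimes> f = x" if "x \<in> carrier R" "x \<otimes> e = x" for x
      using m_assoc[of x e f] that ef \<open>e \<in> idempotents R\<close> \<open>f \<in> idempotents R\<close>
      by (simp add: idempotents_def)
    then show "?p e \<subseteq> ?p f" by blast
  qed
qed

lemma idempotents_opposite_ring: "idempotents (opposite_ring R) = idempotents R"
  by (simp add: idempotents_def opposite_ring_def)

lemma idem_le_opposite_ring: "idem_le (opposite_ring R) = idem_le R"
  by (auto simp: fun_eq_iff idem_le_def opposite_ring_def)

lemma has_dev_right_regular:
  fixes \<alpha> :: "'c deviation"
  shows "has_dev (direct_summands (opposite_ring R) (right_regular R)) (\<subseteq>) \<alpha> \<longleftrightarrow>
    has_dev (idempotents R) (idem_le R) \<alpha>"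
  unfolding right_regular_def ring.has_dev_left_regular[OF ring_opposite_ring]
    idempotents_opposite_ring idem_le_opposite_ring by (rule refl)

end

section \<open>Summands of a module\<close>

context left_module
begin

text \<open>
  A summand is the set of fixed points of the projection onto it along a complement. The fixed
  points of \<open>e\<close> are contained in those of \<open>f\<close> iff \<open>fe = e\<close>, the preorder of the opposite ring.
\<close>

lemma has_dev_direct_summands:
  fixes \<alpha> :: "'c deviation"
  shows "has_dev (direct_summands R M) (\<subseteq>) \<alpha> \<longleftrightarrow>
    has_dev (idempotents (End_ring R M)) (idem_le (End_ring R M)) \<alpha>"
proof -
  let ?E = "End_ring R M"
  let ?p = "\<lambda>e. {x \<in> carrier M. e x = x}"
  interpret E: ring ?E by (rule ring_End_ring)
  have carE: "carrier ?E = module_endomorphisms R M" by (simp add: End_ring_def)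
  have multE: "(f \<otimes>\<^bsub>?E\<^esub> g) = compose (carrier M) f g" for f g by (simp add: End_ring_def)
  have closed: "f x \<in> carrier M" if "f \<in> carrier ?E" "x \<in> carrier M" for f x
    using that by (auto simp: carE module_endomorphisms_def)
  have add: "f (x \<oplus>\<^bsub>M\<^esub> y) = f x \<oplus>\<^bsub>M\<^esub> f y"
    if "f \<in> carrier ?E" "x \<in> carrier M" "y \<in> carrier M" for f x y
    using that by (auto simp: carE module_endomorphisms_def)
  have smult: "f (a \<odot>\<^bsub>M\<^esub> x) = a \<odot>\<^bsub>M\<^esub> f x"
    if "f \<in> carrier ?E" "a \<in> carrier R" "x \<in> carrier M" for f a x
    using that by (auto simp: carE module_endomorphisms_def)
  have ext: "f = g" if "f \<in> carrier ?E" "g \<in> carrier ?E" "\<And>x. x \<in> carrier M \<Longrightarrow> f x = g x" for f g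
    using that unfolding carE module_endomorphisms_def by (auto intro: PiE_ext)
  have zero: "f \<zero>\<^bsub>M\<^esub> = \<zero>\<^bsub>M\<^esub>" if "f \<in> carrier ?E" for f
    using add[OF that M.zero_closed M.zero_closed] closed[OF that M.zero_closed]
    by (metis M.add.r_cancel_one' M.r_zero M.zero_closed)
  have uminus: "f (\<ominus>\<^bsub>M\<^esub> x) = \<ominus>\<^bsub>M\<^esub> f x" if "f \<in> carrier ?E" "x \<in> carrier M" for f x
    using add[OF that(1), of "\<ominus>\<^bsub>M\<^esub> x" x] that closed zero
    by (metis M.a_inv_closed M.l_neg M.minus_equality)
  have idem: "e (e x) = e x" if "e \<in> idempotents ?E" "x \<in> carrier M" for e x
  proof -
    have "compose (carrier M) e e x = e x"
      using that by (simp add: idempotents_def multE)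
    then show ?thesis using that by (simp add: compose_def)
  qed
  have submoduleI: "submodule A R M"
    if "A \<subseteq> carrier M" "\<zero>\<^bsub>M\<^esub> \<in> A" "\<And>x y. x \<in> A \<Longrightarrow> y \<in> A \<Longrightarrow> x \<oplus>\<^bsub>M\<^esub> y \<in> A"
      "\<And>x. x \<in> A \<Longrightarrow> \<ominus>\<^bsub>M\<^esub> x \<in> A" "\<And>a x. a \<in> carrier R \<Longrightarrow> x \<in> A \<Longrightarrow> a \<odot>\<^bsub>M\<^esub> x \<in> A" for A
    using that by (intro submodule.intro subgroup.intro submodule_axioms.intro) (auto simp: a_inv_def)
  have summand: "?p e \<in> direct_summands R M" if e: "e \<in> idempotents ?E" for e
  proof -
    have eE: "e \<in> carrier ?E" using e by (simp add: idempotents_def)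
    let ?k = "{x \<in> carrier M. e x = \<zero>\<^bsub>M\<^esub>}"
    have "submodule (?p e) R M" "submodule ?k R M"
      by (rule submoduleI; auto simp: zero[OF eE] uminus[OF eE] add[OF eE] smult[OF eE] smult_zero)+
    moreover have "?p e \<inter> ?k = {\<zero>\<^bsub>M\<^esub>}" using zero[OF eE] by auto
    moreover have "?p e <+>\<^bsub>M\<^esub> ?k = carrier M"
    proof -
      have "\<exists>a\<in>?p e. \<exists>b\<in>?k. x = a \<oplus>\<^bsub>M\<^esub> b" if x: "x \<in> carrier M" for x
      proof (intro bexI)
        show "x = e x \<oplus>\<^bsub>M\<^esub> (\<ominus>\<^bsub>M\<^esub> e x \<oplus>\<^bsub>M\<^esub> x)" using x closed[OF eE x] by (simp add: M.r_neg2)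
        show "\<ominus>\<^bsub>M\<^esub> e x \<oplus>\<^bsub>M\<^esub> x \<in> ?k"
          using x closed[OF eE x] by (simp add: add[OF eE] uminus[OF eE] idem[OF e] M.l_neg)
        show "e x \<in> ?p e" using x closed[OF eE x] idem[OF e] by simp
      qed
      then show ?thesis unfolding set_add_def' by auto
    qed
    ultimately show ?thesis unfolding direct_summands_def by blast
  qed
  have projection: "\<exists>e\<in>idempotents ?E. A = ?p e" if summ: "A \<in> direct_summands R M" for A
  proof -
    obtain B where A: "submodule A R M" and B: "submodule B R M"
      and int: "A \<inter> B = {\<zero>\<^bsub>M\<^esub>}" and sum: "A <+>\<^bsub>M\<^esub> B = carrier M"
      using summ unfolding direct_summands_def by blast
    note AD = submoduleD[OF A] and BD = submoduleD[OF B]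
    have "\<exists>a b. a \<in> A \<and> b \<in> B \<and> x = a \<oplus>\<^bsub>M\<^esub> b" if "x \<in> carrier M" for x
      using that sum unfolding set_add_def' by blast
    then obtain e0 k where e0: "\<And>x. x \<in> carrier M \<Longrightarrow> e0 x \<in> A"
      "\<And>x. x \<in> carrier M \<Longrightarrow> k x \<in> B" "\<And>x. x \<in> carrier M \<Longrightarrow> x = e0 x \<oplus>\<^bsub>M\<^esub> k x"
      by metis
    have e0_eq: "e0 x = a" if "a \<in> A" "b \<in> B" "x = a \<oplus>\<^bsub>M\<^esub> b" for x a b
    proof -
      have "x \<in> carrier M" using that AD(1) BD(1) by auto
      then show ?thesis
        using submodule_direct_sum_cancel[OF A B int e0(1) that(1) e0(2) that(2)] e0(3) that(3)
        by auto
    qed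
    have fixed: "e0 x = x" if "x \<in> A" for x
      using e0_eq[OF that BD(2)] that AD(1) by auto
    define e where "e = restrict e0 (carrier M)"
    have car: "e0 x \<in> carrier M" "k x \<in> carrier M" if "x \<in> carrier M" for x
      using e0[OF that] AD(1) BD(1) by auto
    have "e \<in> carrier ?E"
      unfolding carE module_endomorphisms_def
    proof (intro CollectI conjI ballI)
      show "e \<in> carrier M \<rightarrow>\<^sub>E carrier M" using car by (auto simp: e_def)
    next
      fix x y assume xy: "x \<in> carrier M" "y \<in> carrier M"
      have "x \<oplus>\<^bsub>M\<^esub> y = (e0 x \<oplus>\<^bsub>M\<^esub> k x) \<oplus>\<^bsub>M\<^esub> (e0 y \<oplus>\<^bsub>M\<^esub> k y)"
        using e0(3)[OF xy(1)] e0(3)[OF xy(2)] by simp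
      also have "\<dots> = (e0 x \<oplus>\<^bsub>M\<^esub> e0 y) \<oplus>\<^bsub>M\<^esub> (k x \<oplus>\<^bsub>M\<^esub> k y)"
        using xy car by (simp add: M.a_ac)
      finally have "e0 (x \<oplus>\<^bsub>M\<^esub> y) = e0 x \<oplus>\<^bsub>M\<^esub> e0 y"
        using e0 xy AD BD by (intro e0_eq) auto
      then show "e (x \<oplus>\<^bsub>M\<^esub> y) = e x \<oplus>\<^bsub>M\<^esub> e y" using xy by (simp add: e_def)
    next
      fix a x assume ax: "a \<in> carrier R" "x \<in> carrier M"
      have "a \<odot>\<^bsub>M\<^esub> x = a \<odot>\<^bsub>M\<^esub> (e0 x \<oplus>\<^bsub>M\<^esub> k x)" using e0(3)[OF ax(2)] by simp
      also have "\<dots> = a \<odot>\<^bsub>M\<^esub> e0 x \<oplus>\<^bsub>M\<^esub> a \<odot>\<^bsub>M\<^esub> k x" using ax car by (simp add: smult_r_distr)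
      finally have "e0 (a \<odot>\<^bsub>M\<^esub> x) = a \<odot>\<^bsub>M\<^esub> e0 x"
        using e0 ax AD BD by (intro e0_eq) auto
      then show "e (a \<odot>\<^bsub>M\<^esub> x) = a \<odot>\<^bsub>M\<^esub> e x" using ax by (simp add: e_def)
    qed
    moreover from this have "e \<otimes>\<^bsub>?E\<^esub> e = e"
    proof (intro ext)
      fix x assume x: "x \<in> carrier M"
      show "(e \<otimes>\<^bsub>?E\<^esub> e) x = e x"
        using x car fixed[OF e0(1)[OF x]] by (simp add: multE e_def compose_def)
    qed auto
    ultimately have "e \<in> idempotents ?E" by (simp add: idempotents_def)
    moreover have "A = ?p e"
    proof (intro equalityI subsetI CollectI conjI)
      fix x assume "x \<in> ?p e"
      then show "x \<in> A" using e0(1)[of x] by (auto simp: e_def)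
    qed (use AD(1) fixed in \<open>auto simp: e_def\<close>)
    ultimately show ?thesis by blast
  qed
  have "has_dev (direct_summands R M) (\<subseteq>) \<alpha> \<longleftrightarrow>
      has_dev (idempotents (opposite_ring ?E)) (idem_le (opposite_ring ?E)) \<alpha>"
  proof (rule ring.has_dev_idempotent_preorder[OF E.ring_opposite_ring])
    show "?p ` idempotents (opposite_ring ?E) = direct_summands R M"
      unfolding E.idempotents_opposite_ring using summand projection by (auto simp: image_iff)
  next
    fix e f assume "e \<in> idempotents (opposite_ring ?E)" "f \<in> idempotents (opposite_ring ?E)"
    then have ef: "e \<in> idempotents ?E" "f \<in> idempotents ?E" "e \<in> carrier ?E" "f \<in> carrier ?E"
      unfolding E.idempotents_opposite_ring by (auto simp: idempotents_def)
    have "?p e \<subseteq> ?p f \<longleftrightarrow> f \<otimes>\<^bsub>?E\<^esub> e = e"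
    proof
      assume sub: "?p e \<subseteq> ?p f"
      show "f \<otimes>\<^bsub>?E\<^esub> e = e"
      proof (rule ext)
        fix x assume x: "x \<in> carrier M"
        then have "e x \<in> ?p e" using idem[OF ef(1)] closed[OF ef(3)] by simp
        then show "(f \<otimes>\<^bsub>?E\<^esub> e) x = e x" using sub x by (auto simp: multE compose_def)
      qed (use ef in auto)
    next
      assume fe: "f \<otimes>\<^bsub>?E\<^esub> e = e"
      show "?p e \<subseteq> ?p f"
      proof
        fix x assume "x \<in> ?p e"
        then have x: "x \<in> carrier M" "e x = x" by auto
        have "(f \<otimes>\<^bsub>?E\<^esub> e) x = f (e x)" using x(1) by (simp add: multE compose_def)
        then show "x \<in> ?p f" using fe x by simp
      qed
    qed
    then show "?p e \<subseteq> ?p f \<longleftrightarrow> e \<otimes>\<^bsub>opposite_ring ?E\<^esub> f = e"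
      by (simp add: opposite_ring_def)
  qed
  then show ?thesis unfolding E.idempotents_opposite_ring E.idem_le_opposite_ring .
qed

end

section \<open>Equality of the deviations\<close>

text \<open>
  Each side of the equivalence has its witness over a different type of ordinals, so the
  deviations are assumed to agree over both types.
\<close>

lemma has_deviation_cong:
  fixes A :: "'a set" and B :: "'b set"
  assumes tr: "transp_on A leqA" "transp_on B leqB"
    and a: "\<And>\<alpha> :: ('a \<times> 'a) deviation. has_dev A leqA \<alpha> \<longleftrightarrow> has_dev B leqB \<alpha>"
    and b: "\<And>\<beta> :: ('b \<times> 'b) deviation. has_dev A leqA \<beta> \<longleftrightarrow> has_dev B leqB \<beta>"
  shows "has_deviation A leqA \<longleftrightarrow> has_deviation B leqB"
proof
  assume "has_deviation A leqA"
  then show "has_deviation B leqB"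
    unfolding has_deviation_def[of A] a by (blast intro: has_deviationI[OF tr(2)])
next
  assume "has_deviation B leqB"
  then show "has_deviation A leqA"
    unfolding has_deviation_def[of B] b[symmetric] by (blast intro: has_deviationI[OF tr(1)])
qed

theorem proposition4p2:
  fixes R :: "('r, 'p) ring_scheme" and M :: "('r, 'm, 'q) module_scheme"
  assumes "left_module R M"
  shows
    "let E = End_ring R M in
       (has_deviation (direct_summands R M) (\<subseteq>) \<longleftrightarrow>
          has_deviation (direct_summands E (left_regular E)) (\<subseteq>)) \<and>
       (has_deviation (direct_summands R M) (\<subseteq>) \<longleftrightarrow>
          has_deviation (direct_summands (opposite_ring E) (right_regular E)) (\<subseteq>)) \<and>
       (has_deviation (direct_summands R M) (\<subseteq>) \<longleftrightarrow>
          has_deviation (idempotents E) (idem_le E)) \<and>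
       (has_deviation (direct_summands R M) (\<subseteq>) \<longleftrightarrow>
          has_deviation (idempotents E) (\<lambda>e e'. idem_le E e' e)) \<and>
       (has_deviation (direct_summands R M) (\<subseteq>) \<longrightarrow>
          (\<exists>\<alpha> :: ('m set \<times> 'm set) deviation.
             has_dev (direct_summands R M) (\<subseteq>) \<alpha> \<and>
             has_dev (direct_summands E (left_regular E)) (\<subseteq>) \<alpha> \<and>
             has_dev (direct_summands (opposite_ring E) (right_regular E)) (\<subseteq>) \<alpha> \<and>
             has_dev (idempotents E) (idem_le E) \<alpha> \<and>
             has_dev (idempotents E) (\<lambda>e e'. idem_le E e' e) \<alpha>))"
proof -
  interpret left_module R M by fact
  define E where "E = End_ring R M"
  interpret E: ring E unfolding E_def by (rule ring_End_ring)
  note dev = has_dev_direct_summands[folded E_def] E.has_dev_left_regular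
    E.has_dev_right_regular E.has_dev_dual_idempotents
  have dual: "transp_on (idempotents E) (\<lambda>e e'. idem_le E e' e)"
    using E.transp_on_idem_le unfolding transp_on_def by blast
  note tr = transp_on_subseteq E.transp_on_idem_le dual
  have "has_deviation (direct_summands R M) (\<subseteq>) \<longleftrightarrow>
      has_deviation (direct_summands E (left_regular E)) (\<subseteq>)"
    "has_deviation (direct_summands R M) (\<subseteq>) \<longleftrightarrow>
      has_deviation (direct_summands (opposite_ring E) (right_regular E)) (\<subseteq>)"
    "has_deviation (direct_summands R M) (\<subseteq>) \<longleftrightarrow> has_deviation (idempotents E) (idem_le E)"
    "has_deviation (direct_summands R M) (\<subseteq>) \<longleftrightarrow>
      has_deviation (idempotents E) (\<lambda>e e'. idem_le E e' e)"
    by (rule has_deviation_cong; (rule tr | simp only: dev))+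
  then show ?thesis
    unfolding Let_def E_def[symmetric] dev has_deviation_def[of "direct_summands R M"] by blast
qed

end
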